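(* Let $0<r<q<\infty$, $\epsilon>0$ and $A>0$. Then there is a constant $C>0$, depending only on $d,q,r,\epsilon,A$, such that the following holds. For every sequence $\{f_k\}_{k\in\mathbb{Z}}$ with $f_k\in\mathcal{E}(A2^k)$ for all $k\in\mathbb{Z}$, every $\mu\in\mathbb{Z}$ and every $P\in\mathcal{D}_\mu$, $$\Big(\frac{1}{|P|}\int_P\sum_{k=\mu}^{\infty}\big(\mathcal{M}_r^{k,\epsilon}f_k(x)\big)^q\,dx\Big)^{1/q}\le C\sup_{R\in\mathcal{D}_\mu}\Big(\frac{1}{|R|}\int_R\sum_{k=\mu}^{\infty}|f_k(x)|^q\,dx\Big)^{1/q}.$$ In particular $C$ is independent of $\mu$ and $P$.
   Context: Everything is on $\mathbb{R}^d$, and the Fourier transform is $\widehat{f}(\xi)=\int_{\mathbb{R}^d}f(x)e^{-2\pi i\langle x,\xi\rangle}dx$. For $\rho>0$, $\mathcal{E}(\rho)$ is the space of tempered distributions on $\mathbb{R}^d$ whose Fourier transforms are supported in $\{\xi:|\xi|\le 2\rho\}$ (such distributions are identified with smooth functions). $\mathcal{D}$ is the set of all dyadic cubes in $\mathbb{R}^d$ and $\mathcal{D}_\mu$ is the set of dyadic cubes of side length $2^{-\mu}$. For a cube $Q$, $l(Q)$ denotes its side length. For $\epsilon\ge0$, $r>0$, $k\in\mathbb{Z}$, $$\mathcal{M}_r^{k,\epsilon}f(x):=\sup_{2^kl(Q)\le1,\,x\in Q}\Big(\frac{1}{|Q|}\int_Q|f(y)|^r\,dy\Big)^{1/r}+\sup_{2^kl(Q)>1,\,x\in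 Q}\big(2^kl(Q)\big)^{-\epsilon}\Big(\frac{1}{|Q|}\int_Q|f(y)|^r\,dy\Big)^{1/r},$$ where the suprema are over all cubes $Q$ (not only dyadic ones) containing $x$ and satisfying the indicated size condition. *)

theory Defs
  imports "HOL-Analysis.Analysis"
begin

primrec partials :: "(real^'n) list \<Rightarrow> (real^'n \<Rightarrow> complex) \<Rightarrow> real^'n \<Rightarrow> complex" where
  "partials [] f = f"
| "partials (v # vs) f = (\<lambda>x. frechet_derivative (partials vs f) (at x) v)"

text \<open>Multi-indices are encoded as lists of coordinate directions. The iterated partials may only be
  read as derivatives when all of them are differentiable, which is what smoothness demands.\<close>

definition smooth :: "(real^'n \<Rightarrow> complex) \<Rightarrow> bool" where
  "smooth f \<longleftrightarrow> (\<forall>vs\<in>lists Basis. \<forall>x. partials vs f differentiable (at x))"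

definition schwartz :: "(real^'n \<Rightarrow> complex) set" where
  "schwartz = {\<phi>. smooth \<phi> \<and>
     (\<forall>vs\<in>lists Basis. \<forall>N::nat. \<exists>B. \<forall>x. (1 + norm x) ^ N * norm (partials vs \<phi> x) \<le> B)}"

text \<open>An increasing family of norms generating the topology of the Schwartz space.\<close>

definition schwartz_norm :: "nat \<Rightarrow> (real^'n \<Rightarrow> complex) \<Rightarrow> real" where
  "schwartz_norm N \<phi> =
     (SUP (vs, x)\<in>{vs\<in>lists Basis. length vs \<le> N} \<times> UNIV. (1 + norm x) ^ N * norm (partials vs \<phi> x))"

definition test_function :: "(real^'n \<Rightarrow> complex) \<Rightarrow> bool" where
  "test_function \<phi> \<longleftrightarrow> smooth \<phi> \<and> compact (closure {x. \<phi> x \<noteq> 0})"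

text \<open>Only the values of a functional on Schwartz functions are meaningful.\<close>

definition tempered_distribution :: "((real^'n \<Rightarrow> complex) \<Rightarrow> complex) \<Rightarrow> bool" where
  "tempered_distribution T \<longleftrightarrow>
     (\<forall>\<phi>\<in>schwartz. \<forall>\<psi>\<in>schwartz. T (\<lambda>x. \<phi> x + \<psi> x) = T \<phi> + T \<psi>) \<and>
     (\<forall>c. \<forall>\<phi>\<in>schwartz. T (\<lambda>x. c * \<phi> x) = c * T \<phi>) \<and>
     (\<forall>\<phi>\<in>schwartz. \<forall>e>0. \<exists>N. \<exists>\<delta>>0. \<forall>\<psi>\<in>schwartz.
        schwartz_norm N (\<lambda>x. \<psi> x - \<phi> x) < \<delta> \<longrightarrow> norm (T \<psi> - T \<phi>) < e)"

definition fourier :: "(real^'n \<Rightarrow> complex) \<Rightarrow> real^'n \<Rightarrow> complex" where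
  "fourier \<phi> \<xi> = (LINT x|lborel. \<phi> x * exp (- 2 * of_real pi * \<i> * of_real (x \<bullet> \<xi>)))"

definition fourier_distr ::
    "((real^'n \<Rightarrow> complex) \<Rightarrow> complex) \<Rightarrow> (real^'n \<Rightarrow> complex) \<Rightarrow> complex" where
  "fourier_distr T \<phi> = T (fourier \<phi>)"

definition distr_support :: "((real^'n \<Rightarrow> complex) \<Rightarrow> complex) \<Rightarrow> (real^'n) set" where
  "distr_support U = \<Inter>{K. closed K \<and>
     (\<forall>\<phi>. test_function \<phi> \<and> closure {x. \<phi> x \<noteq> 0} \<inter> K = {} \<longrightarrow> U \<phi> = 0)}"

text \<open>The space \<open>\<E>(\<rho>)\<close>: a distribution with compactly supported Fourier transform is identified with
  the smooth function representing it. Test functions suffice to express this, since they are dense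
  in the Schwartz space.\<close>

definition band_limited :: "real \<Rightarrow> (real^'n \<Rightarrow> complex) set" where
  "band_limited \<rho> = {f. smooth f \<and> (\<exists>T. tempered_distribution T \<and>
     (\<forall>\<phi>. test_function \<phi> \<longrightarrow> T \<phi> = (LINT x|lborel. f x * \<phi> x)) \<and>
     distr_support (fourier_distr T) \<subseteq> {\<xi>. norm \<xi> \<le> 2 * \<rho>})}"

text \<open>Cubes are half-open, so that dyadic cubes of a given size tile the space. Including or excluding
  faces changes neither the averages below nor the maximal function: a cube having \<open>x\<close> on its boundary
  is a limit of cubes of the same size having \<open>x\<close> in the interior.\<close>

definition cube :: "real^'n \<Rightarrow> real \<Rightarrow> (real^'n) set" where
  "cube a l = {x. \<forall>i. a $ i \<le> x $ i \<and> x $ i < a $ i + l}"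

definition dyadic_cubes :: "int \<Rightarrow> (real^'n) set set" where
  "dyadic_cubes \<mu> = range (\<lambda>m :: int^'n. cube (\<chi> i. 2 powi (- \<mu>) * of_int (m $ i)) (2 powi (- \<mu>)))"

text \<open>Real powers on \<open>[0, \<infinity>]\<close>; only positive exponents are used.\<close>

definition epowr :: "ennreal \<Rightarrow> real \<Rightarrow> ennreal" where
  "epowr x p = (if x = \<infinity> then \<infinity> else ennreal (enn2real x powr p))"

definition average :: "(real^'n) set \<Rightarrow> (real^'n \<Rightarrow> ennreal) \<Rightarrow> ennreal" where
  "average Q g = (\<integral>\<^sup>+x\<in>Q. g x \<partial>lborel) / emeasure lborel Q"

definition maximal :: "real \<Rightarrow> int \<Rightarrow> real \<Rightarrow> (real^'n \<Rightarrow> complex) \<Rightarrow> real^'n \<Rightarrow> ennreal" where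
  "maximal r k \<epsilon> f x =
     (SUP (a, l)\<in>{(a, l). 0 < l \<and> 2 powi k * l \<le> 1 \<and> x \<in> cube a l}.
        epowr (average (cube a l) (\<lambda>y. ennreal (norm (f y) powr r))) (1 / r)) +
     (SUP (a, l)\<in>{(a, l). 0 < l \<and> 2 powi k * l > 1 \<and> x \<in> cube a l}.
        ennreal ((2 powi k * l) powr (- \<epsilon>)) *
        epowr (average (cube a l) (\<lambda>y. ennreal (norm (f y) powr r))) (1 / r))"

end

theory Submission
  imports Defs
begin

text \<open>Let \<open>S\<close> be the supremum on the right-hand side. A cube of side at most \<open>2\<^sup>-\<^sup>\<mu>\<close> that meets \<open>P\<close> lies in the
  threefold dilate of \<open>P\<close>, so these cubes are handled by the Hardy--Littlewood maximal theorem on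
  \<open>L\<^sup>p\<close> with \<open>p = q / r > 1\<close>, applied to each \<open>|f\<^sub>k|\<^sup>r\<close> restricted to that dilate and summed over \<open>k\<close>.
  A cube of larger side is covered by dyadic cubes of side \<open>2\<^sup>-\<^sup>\<mu>\<close> with comparable total measure, so
  its average of \<open>|f\<^sub>k|\<^sup>r\<close> is bounded by a multiple of \<open>S\<^sup>r\<close>, and the weight
  \<open>(2\<^sup>k l(Q))\<^sup>-\<^sup>\<epsilon>\<close> then supplies a factor \<open>2\<^sup>-\<^sup>\<epsilon>\<^sup>(\<^sup>k\<^sup>-\<^sup>\<mu>\<^sup>)\<close> that makes the sum over \<open>k\<close> converge.\<close>

section \<open>Cubes and the weak-type inequality\<close>

lemma sets_cube [measurable]: "cube a l \<in> sets borel"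
proof -
  have "cube a l = (\<Inter>i\<in>UNIV. {x. a $ i \<le> x $ i} \<inter> {x. x $ i < a $ i + l})"
    by (auto simp: cube_def)
  also have "\<dots> \<in> sets borel"
    by (intro sets.finite_INT) (auto intro!: sets.Int borel_closed borel_open
          closed_Collect_le open_Collect_less continuous_intros)
  finally show ?thesis .
qed

text \<open>The half-open cube lies between an open and a closed box of equal volume, so its faces
  do not affect the measure.\<close>

lemma emeasure_cube:
  fixes a :: "real^'n"
  assumes "0 \<le> l"
  shows "emeasure lborel (cube a l) = ennreal (l ^ CARD('n))"
proof -
  let ?b = "a + (\<chi> i. l)"
  have "\<And>b. b \<in> Basis \<Longrightarrow> a \<bullet> b \<le> ?b \<bullet> b"
    using assms by (auto simp: Basis_vec_def inner_axis)
  then have "emeasure lborel (cbox a ?b) = ennreal (l ^ CARD('n))"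
    and "emeasure lborel (box a ?b) = ennreal (l ^ CARD('n))"
    using assms by (auto simp: emeasure_lborel_cbox_eq emeasure_lborel_box_eq Basis_vec_def
        inner_axis UNION_singleton_eq_range prod.reindex inj_on_def axis_eq_axis)
  moreover have "box a ?b \<subseteq> cube a l" "cube a l \<subseteq> cbox a ?b"
    by (auto simp: cube_def mem_box_cart less_imp_le)
  ultimately show ?thesis
    using emeasure_mono[of "box a ?b" "cube a l" lborel] emeasure_mono[of "cube a l" "cbox a ?b" lborel]
    by (simp add: antisym)
qed

text \<open>The l1 norm dominates the Euclidean norm, whence the crude factor
  \<open>CARD('n)\<close>. The ball makes the Vitali covering lemma for balls applicable to
  cubes.\<close>

lemma cube_subset_cball:
  fixes a :: "real^'n"
  shows "cube a l \<subseteq> cball a (of_nat CARD('n) * l)"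
proof
  fix x assume x: "x \<in> cube a l"
  have "dist a x \<le> (\<Sum>i\<in>UNIV. \<bar>(a - x) $ i\<bar>)"
    unfolding dist_norm by (rule norm_le_l1_cart)
  also have "\<dots> \<le> (\<Sum>i\<in>(UNIV :: 'n set). l)"
    using x by (intro sum_mono) (auto simp: cube_def abs_le_iff less_imp_le algebra_simps)
  finally show "x \<in> cball a (of_nat CARD('n) * l)" by simp
qed

text \<open>The strict inequality makes up for the missing upper faces of the half-open
  cube.\<close>

lemma cball_subset_cube:
  fixes a :: "real^'n"
  assumes "2 * \<rho> < l"
  shows "cball a \<rho> \<subseteq> cube (a - (\<chi> i. \<rho>)) l"
proof
  fix x assume "x \<in> cball a \<rho>"
  then have "\<bar>(a - x) $ i\<bar> \<le> \<rho>" for i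
    using component_le_norm_cart[of "a - x" i] by (auto simp: dist_norm)
  then show "x \<in> cube (a - (\<chi> i. \<rho>)) l"
    using assms by (simp add: cube_def abs_le_iff) (smt (verit))
qed

lemma average_cube_le_iff:
  fixes a :: "real^'n"
  assumes "0 < l"
  shows "average (cube a l) g \<le> t \<longleftrightarrow> (\<integral>\<^sup>+x\<in>cube a l. g x \<partial>lborel) \<le> t * ennreal (l ^ CARD('n))"
proof -
  have "x / ennreal c \<le> t \<longleftrightarrow> x \<le> t * ennreal c" if "0 < c" for x c
  proof
    assume "x / ennreal c \<le> t"
    then have "x / ennreal c * ennreal c \<le> t * ennreal c"
      by (intro mult_right_mono) auto
    then show "x \<le> t * ennreal c"
      using that by (simp add: ennreal_divide_times ennreal_mult_divide_eq)
  next
    assume "x \<le> t * ennreal c"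
    then have "x / ennreal c \<le> t * ennreal c / ennreal c"
      by (rule divide_right_mono_ennreal)
    then show "x / ennreal c \<le> t"
      using that by (simp add: ennreal_mult_divide_eq)
  qed
  then show ?thesis
    using assms unfolding average_def by (simp add: emeasure_cube)
qed

text \<open>This is countable additivity of the measure with density \<open>g\<close>. An arbitrary
  countable index set is allowed so that families of cubes can index themselves.\<close>

lemma nn_integral_UN_disjoint:
  assumes g [measurable]: "g \<in> borel_measurable M"
    and I: "countable I" and X: "\<And>i. i \<in> I \<Longrightarrow> X i \<in> sets M" and d: "disjoint_family_on X I"
  shows "(\<integral>\<^sup>+x\<in>(\<Union>i\<in>I. X i). g x \<partial>M) = (\<integral>\<^sup>+i. (\<integral>\<^sup>+x\<in>X i. g x \<partial>M) \<partial>count_space I)"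
proof -
  have "(\<integral>\<^sup>+x\<in>(\<Union>i\<in>I. X i). g x \<partial>M) = emeasure (density M g) (\<Union>i\<in>I. X i)"
    using I X by (subst emeasure_density) auto
  also have "\<dots> = (\<integral>\<^sup>+i. emeasure (density M g) (X i) \<partial>count_space I)"
    using I X d by (intro emeasure_UN_countable) auto
  also have "\<dots> = (\<integral>\<^sup>+i. (\<integral>\<^sup>+x\<in>X i. g x \<partial>M) \<partial>count_space I)"
    using X by (intro nn_integral_cong) (simp add: emeasure_density)
  finally show ?thesis .
qed

text \<open>The indicator of a union is at most the sum of the indicators; integrate and
  exchange.\<close>

lemma emeasure_UN_le:
  assumes I: "countable I" and X: "\<And>i. i \<in> I \<Longrightarrow> X i \<in> sets M"
  shows "emeasure M (\<Union>i\<in>I. X i) \<le> (\<integral>\<^sup>+i. emeasure M (X i) \<partial>count_space I)"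
proof -
  have "emeasure M (\<Union>i\<in>I. X i) = (\<integral>\<^sup>+x. indicator (\<Union>i\<in>I. X i) x \<partial>M)"
    using I X by (subst nn_integral_indicator) auto
  also have "\<dots> \<le> (\<integral>\<^sup>+x. (\<integral>\<^sup>+i. indicator (X i) x \<partial>count_space I) \<partial>M)"
  proof (intro nn_integral_mono)
    fix x
    show "(indicator (\<Union>i\<in>I. X i) x :: ennreal) \<le> (\<integral>\<^sup>+i. indicator (X i) x \<partial>count_space I)"
    proof (cases "x \<in> (\<Union>i\<in>I. X i)")
      case True
      then obtain i where i: "i \<in> I" "x \<in> X i" by auto
      then show ?thesis
        using nn_integral_ge_point[of i I "\<lambda>i. indicator (X i) x"] True by simp
    qed simp
  qed
  also have "\<dots> = (\<integral>\<^sup>+i. emeasure M (X i) \<partial>count_space I)"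
    using I X by (subst nn_integral_count_space_nn_integral) (auto intro!: nn_integral_cong)
  finally show ?thesis .
qed

text \<open>Vitali's lemma selects, among the cubes with average at least \<open>t\<close>,
  countably many whose surrounding balls are disjoint while the fivefold balls cover all the others.
  Summing \<open>t\<close> times the volume over the selected cubes costs at most the integral of
  \<open>h\<close>. A Borel set \<open>F\<close> containing the superlevel set replaces that set
  itself. The bound \<open>L\<close> keeps the radii bounded, as Vitali's lemma requires; the
  constant is independent of it.\<close>

lemma weak_type_cubes:
  fixes h :: "real^'n \<Rightarrow> ennreal"
  assumes h [measurable]: "h \<in> borel_measurable borel"
  obtains F where "F \<in> sets borel"
    and "\<And>x a l. \<lbrakk>0 < l; l \<le> L; x \<in> cube a l; t * ennreal (l ^ CARD('n)) \<le> (\<integral>\<^sup>+y\<in>cube a l. h y \<partial>lborel)\<rbrakk> \<Longrightarrow> x \<in> F"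
    and "t * emeasure lborel F \<le> ennreal ((11 * CARD('n)) ^ CARD('n)) * (\<integral>\<^sup>+y. h y \<partial>lborel)"
proof -
  let ?d = "CARD('n)"
  define K where "K = {(a :: real^'n, l :: real). 0 < l \<and> l \<le> L \<and>
    t * ennreal (l ^ CARD('n)) \<le> (\<integral>\<^sup>+y\<in>cube a l. h y \<partial>lborel)}"
  obtain C where C: "countable C" "C \<subseteq> K"
    and dC: "pairwise (\<lambda>i j. disjnt (cball (fst i) (real ?d * snd i)) (cball (fst j) (real ?d * snd j))) C"
    and cov: "(\<Union>i\<in>K. cball (fst i) (real ?d * snd i)) \<subseteq> (\<Union>i\<in>C. cball (fst i) (5 * (real ?d * snd i)))"
  proof (rule Vitali_covering_lemma_cballs[OF order_refl, of K "\<lambda>i. real ?d * snd i" "real ?d * L" fst])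
    show "0 < real ?d * snd i \<and> real ?d * snd i \<le> real ?d * L" if "i \<in> K" for i
      using that by (auto simp: K_def)
  qed
  \<comment> \<open>A ball of radius \<open>5dl\<close> has diameter \<open>10dl\<close>; the factor 11 leaves room for the half-open faces.\<close>
  define F where "F = (\<Union>i\<in>C. cube (fst i - (\<chi> j. 5 * (real ?d * snd i))) (11 * real ?d * snd i))"
  have pos: "0 < snd i" if "i \<in> C" for i using that C by (auto simp: K_def)
  show ?thesis
  proof
    show "F \<in> sets borel"
      unfolding F_def using C by (intro sets.countable_UN') auto
    show "x \<in> F" if "0 < l" "l \<le> L" "x \<in> cube a l"
      "t * ennreal (l ^ CARD('n)) \<le> (\<integral>\<^sup>+y\<in>cube a l. h y \<partial>lborel)" for x a l
    proof -
      have "x \<in> (\<Union>i\<in>K. cball (fst i) (real ?d * snd i))"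
        using that cube_subset_cball[of a l] by (intro UN_I[of "(a, l)"]) (auto simp: K_def)
      then obtain i where i: "i \<in> C" "x \<in> cball (fst i) (5 * (real ?d * snd i))"
        using cov by blast
      have "2 * (5 * (real ?d * snd i)) < 11 * real ?d * snd i"
        using pos[OF i(1)] by simp
      from cball_subset_cube[OF this, of "fst i"] i show ?thesis
        unfolding F_def by blast
    qed
    have cub: "emeasure lborel (cube (fst i - (\<chi> j. 5 * (real ?d * snd i))) (11 * real ?d * snd i))
        = ennreal ((11 * ?d) ^ ?d) * ennreal (snd i ^ ?d)" if "i \<in> C" for i
      using pos[OF that] by (subst emeasure_cube) (auto simp: power_mult_distrib ennreal_mult)
    have "t * emeasure lborel F
        \<le> t * (\<integral>\<^sup>+i. ennreal ((11 * ?d) ^ ?d) * ennreal (snd i ^ ?d) \<partial>count_space C)"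
      unfolding F_def
      by (intro mult_left_mono order_trans[OF emeasure_UN_le] nn_integral_mono) (auto simp: C cub)
    also have "\<dots> = ennreal ((11 * ?d) ^ ?d) * (\<integral>\<^sup>+i. t * ennreal (snd i ^ ?d) \<partial>count_space C)"
      by (simp add: nn_integral_cmult mult.left_commute)
    also have "\<dots> \<le> ennreal ((11 * ?d) ^ ?d) *
        (\<integral>\<^sup>+i. (\<integral>\<^sup>+y\<in>cube (fst i) (snd i). h y \<partial>lborel) \<partial>count_space C)"
      using C by (intro mult_left_mono nn_integral_mono) (auto simp: K_def)
    also have "\<dots> = ennreal ((11 * ?d) ^ ?d) * (\<integral>\<^sup>+y\<in>(\<Union>i\<in>C. cube (fst i) (snd i)). h y \<partial>lborel)"
    proof (subst nn_integral_UN_disjoint)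
      show "disjoint_family_on (\<lambda>i. cube (fst i) (snd i)) C"
        unfolding disjoint_family_on_def
      proof (intro ballI impI)
        fix i j assume "i \<in> C" "j \<in> C" "i \<noteq> j"
        then have "disjnt (cball (fst i) (real ?d * snd i)) (cball (fst j) (real ?d * snd j))"
          using dC by (auto simp: pairwise_def)
        then show "cube (fst i) (snd i) \<inter> cube (fst j) (snd j) = {}"
          using cube_subset_cball[of "fst i" "snd i"] cube_subset_cball[of "fst j" "snd j"]
          unfolding disjnt_def by blast
      qed
    qed (auto simp: C)
    also have "\<dots> \<le> ennreal ((11 * ?d) ^ ?d) * (\<integral>\<^sup>+y. h y \<partial>lborel)"
      by (intro mult_left_mono nn_integral_mono) (auto split: split_indicator)
    finally show "t * emeasure lborel F \<le> ennreal ((11 * ?d) ^ ?d) * (\<integral>\<^sup>+y. h y \<partial>lborel)" .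
  qed
qed

section \<open>Real powers on the extended half-line\<close>

lemma epowr_mono: "x \<le> y \<Longrightarrow> 0 \<le> p \<Longrightarrow> epowr x p \<le> epowr y p"
  by (auto simp: epowr_def less_top[symmetric] top_unique intro!: ennreal_leI powr_mono2 enn2real_mono)

lemma epowr_ennreal: "0 \<le> x \<Longrightarrow> epowr (ennreal x) p = ennreal (x powr p)"
  by (simp add: epowr_def)

lemma epowr_epowr: "epowr (epowr x p) q = epowr x (p * q)"
  by (auto simp: epowr_def powr_powr)

lemma epowr_inverse: "0 < p \<Longrightarrow> epowr (epowr x (1 / p)) p = x"
  by (cases x) (auto simp: epowr_def powr_powr)

lemma epowr_mult_ennreal:
  assumes "0 < c" "0 < p"
  shows "epowr (ennreal c * x) p = ennreal (c powr p) * epowr x p"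
  using assms by (cases x)
    (auto simp: epowr_def ennreal_mult_top ennreal_mult[symmetric] powr_mult)

text \<open>The maximum is one of its two arguments, so no constant arises as it would for the power
  of a sum.\<close>

lemma epowr_max_le: "epowr (max x y) p \<le> epowr x p + epowr y p"
  by (auto simp: max_def)

section \<open>The strong-type inequality\<close>

text \<open>The admissible levels form a geometric series running down from the largest one, whose
  term is at most \<open>(2 * t) powr s\<close>. The decoding \<open>int_decode\<close> lets a
  series over the naturals range over all integers.\<close>

lemma dyadic_levels_sum_le:
  assumes s: "0 < s" and t: "0 \<le> t"
  shows "(\<Sum>n. ennreal (2 powr (of_int (int_decode n) * s)) *
            indicator {j. 2 powr (of_int j - 1) < t} (int_decode n))
      \<le> ennreal (2 powr s / (1 - 2 powr - s) * t powr s)"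
proof (cases "t = 0")
  case True
  then show ?thesis by simp
next
  case False
  with t have t: "0 < t" by simp
  \<comment> \<open>This is the largest \<open>j\<close> with
    \<open>2 powr (j - 1) < t\<close>.\<close>
  define J where "J = \<lceil>log 2 t\<rceil>"
  define F where "F j = ennreal (2 powr (of_int j * s)) * indicator {j. 2 powr (of_int j - 1) < t} j" for j :: int
  have J: "j \<le> J" if "2 powr (of_int j - 1) < t" for j :: int
  proof -
    have "of_int j - 1 < log 2 t" using that t by (simp add: less_log_iff)
    also have "\<dots> \<le> of_int J" by (simp add: J_def)
    finally show ?thesis by linarith
  qed
  have "2 powr of_int J \<le> 2 powr (log 2 t + 1)"
  proof (rule powr_mono)
    show "of_int J \<le> log 2 t + 1" unfolding J_def by linarith
  qed simp
  then have J2: "2 powr of_int J \<le> 2 * t" using t by (simp add: powr_add)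
  have sums: "(\<lambda>n. 2 powr (of_int J * s) * (2 powr - s) ^ n) sums (2 powr (of_int J * s) * (1 / (1 - 2 powr - s)))"
    using s by (intro sums_mult geometric_sums) (simp add: powr_less_one)
  \<comment> \<open>Counting down from \<open>J\<close> turns the sum over all integers up to
    \<open>J\<close> into an ordinary geometric series.\<close>
  have bij: "bij_betw (\<lambda>n. J - int n) UNIV {..J}"
    by (rule bij_betwI[of _ _ _ "\<lambda>j. nat (J - j)"]) auto
  have "(\<Sum>n. F (int_decode n)) = (\<integral>\<^sup>+n. F (int_decode n) \<partial>count_space UNIV)"
    by (simp add: nn_integral_count_space_nat)
  also have "\<dots> = (\<integral>\<^sup>+j. F j \<partial>count_space UNIV)"
    by (rule nn_integral_bij_count_space) (rule bij_int_decode)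
  also have "\<dots> \<le> (\<integral>\<^sup>+j. ennreal (2 powr (of_int j * s)) * indicator {..J} j \<partial>count_space UNIV)"
    using J by (intro nn_integral_mono) (auto simp: F_def split: split_indicator)
  also have "\<dots> = (\<integral>\<^sup>+j. ennreal (2 powr (of_int j * s)) \<partial>count_space {..J})"
    by (simp add: nn_integral_count_space_indicator)
  also have "\<dots> = (\<integral>\<^sup>+n. ennreal (2 powr (of_int (J - int n) * s)) \<partial>count_space UNIV)"
    by (rule nn_integral_bij_count_space[OF bij, symmetric])
  also have "\<dots> = (\<Sum>n. ennreal (2 powr (of_int J * s) * (2 powr - s) ^ n))"
    by (simp add: nn_integral_count_space_nat algebra_simps powr_diff powr_minus powr_realpow[symmetric]
        powr_powr field_simps)
  also have "\<dots> = ennreal (2 powr (of_int J * s) * (1 / (1 - 2 powr - s)))"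
    using sums by (intro suminf_ennreal_eq) auto
  also have "\<dots> \<le> ennreal (2 powr s / (1 - 2 powr - s) * t powr s)"
  proof (rule ennreal_leI)
    have "2 powr (of_int J * s) = (2 powr of_int J) powr s" by (simp add: powr_powr)
    also have "\<dots> \<le> (2 * t) powr s" using J2 s by (intro powr_mono2) auto
    also have "\<dots> = 2 powr s * t powr s" using t by (simp add: powr_mult)
    finally have "2 powr (of_int J * s) / (1 - 2 powr - s) \<le> 2 powr s * t powr s / (1 - 2 powr - s)"
      using s by (intro divide_right_mono) (auto intro: less_imp_le simp: powr_less_one)
    then show "2 powr (of_int J * s) * (1 / (1 - 2 powr - s)) \<le> 2 powr s / (1 - 2 powr - s) * t powr s"
      by simp
  qed
  finally show ?thesis by (simp add: F_def)
qed

text \<open>The ceiling minus one, rather than the floor, gives a level strictly below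
  \<open>t\<close>, which is what membership in \<open>F j\<close> will require.\<close>

lemma dyadic_level_exists:
  assumes "0 < (t::real)"
  obtains j :: int where "2 powr of_int j < t" "t \<le> 2 powr (of_int j + 1)"
proof
  let ?j = "\<lceil>log 2 t\<rceil> - 1"
  have "of_int ?j < log 2 t" "log 2 t \<le> of_int ?j + 1" by linarith+
  then show "2 powr of_int ?j < t" "t \<le> 2 powr (of_int ?j + 1)"
    using assms by (simp_all only: less_log_iff log_le_iff)
qed

text \<open>The majorant \<open>G\<close> stands in for the maximal function of half-open cubes, whose measurability is
  unclear. Interpolation between weak \<open>L\<^sup>1\<close> and \<open>L\<^sup>\<infinity>\<close> is done on the dyadic levels \<open>2\<^sup>j\<close>, where only the
  part of \<open>h\<close> exceeding half the level matters.\<close>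

lemma maximal_function_strong_type:
  fixes p :: real
  assumes p: "1 < p"
  shows "\<exists>C>0. \<forall>(h :: real^'n \<Rightarrow> real) L. h \<in> borel_measurable borel \<and> (\<forall>y. 0 \<le> h y) \<longrightarrow>
    (\<exists>G\<in>borel_measurable borel.
      (\<forall>x a l. 0 < l \<and> l \<le> L \<and> x \<in> cube a l \<longrightarrow> epowr (average (cube a l) (\<lambda>y. ennreal (h y))) p \<le> G x) \<and>
      (\<integral>\<^sup>+x. G x \<partial>lborel) \<le> ennreal C * (\<integral>\<^sup>+y. ennreal (h y powr p) \<partial>lborel))"
proof -
  define s where "s = p - 1"
  define K where "K = real (11 * CARD('n)) ^ CARD('n)"
  define B where "B = 2 powr s / (1 - 2 powr - s)"
  have s: "0 < s" using p by (simp add: s_def)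
  have K: "0 < K" by (simp add: K_def)
  have B: "0 < B" unfolding B_def using s by (intro divide_pos_pos) (auto simp: powr_less_one)
  show ?thesis
  proof (intro exI[of _ "2 powr (p + 1) * K * B"] conjI allI impI)
    show "0 < 2 powr (p + 1) * K * B" using K B by simp
    fix h :: "real^'n \<Rightarrow> real" and L :: real
    assume "h \<in> borel_measurable borel \<and> (\<forall>y. 0 \<le> h y)"
    then have h [measurable]: "h \<in> borel_measurable borel" and h0: "\<And>y. 0 \<le> h y" by auto
    \<comment> \<open>What is cut off from \<open>h\<close> is at most
      \<open>2 powr (j - 1)\<close>, so it accounts for at most half of an average above
      \<open>2 powr j\<close>.\<close>
    define u where "u j y = ennreal (h y) * indicator {y. 2 powr (of_int j - 1) < h y} y" for j :: int and y
    have u [measurable]: "u j \<in> borel_measurable borel" for j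
      unfolding u_def by measurable
    \<comment> \<open>The properties of the weak-type set are bundled so that one set per level can
      be chosen at once.\<close>
    define W where "W j E \<longleftrightarrow> E \<in> sets borel \<and>
        (\<forall>x a l. 0 < l \<and> l \<le> L \<and> x \<in> cube a l \<and>
          ennreal (2 powr (of_int j - 1)) * ennreal (l ^ CARD('n)) \<le> (\<integral>\<^sup>+y\<in>cube a l. u j y \<partial>lborel) \<longrightarrow> x \<in> E) \<and>
        ennreal (2 powr (of_int j - 1)) * emeasure lborel E \<le> ennreal K * (\<integral>\<^sup>+y. u j y \<partial>lborel)"
      for j :: int and E
    have "\<exists>E. W j E" for j
      by (rule weak_type_cubes[OF u, of L "ennreal (2 powr (of_int j - 1))" j]) (auto simp: W_def K_def)
    then obtain F where W: "\<And>j. W j (F j)"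
      by metis
    then have F [measurable]: "\<And>j. F j \<in> sets borel"
      and F1: "\<And>j x a l. 0 < l \<Longrightarrow> l \<le> L \<Longrightarrow> x \<in> cube a l \<Longrightarrow>
        ennreal (2 powr (of_int j - 1)) * ennreal (l ^ CARD('n)) \<le> (\<integral>\<^sup>+y\<in>cube a l. u j y \<partial>lborel) \<Longrightarrow> x \<in> F j"
      and F2: "\<And>j. ennreal (2 powr (of_int j - 1)) * emeasure lborel (F j) \<le> ennreal K * (\<integral>\<^sup>+y. u j y \<partial>lborel)"
      unfolding W_def by blast+
    \<comment> \<open>An average in the interval from \<open>2 powr j\<close> to
      \<open>2 powr (j + 1)\<close> forces \<open>x\<close> into \<open>F j\<close>, and the single
      term for this \<open>j\<close> already dominates its power \<open>p\<close>.\<close>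
    define G where "G x = (\<Sum>n. ennreal (2 powr ((of_int (int_decode n) + 1) * p)) * indicator (F (int_decode n)) x)" for x
    have G [measurable]: "G \<in> borel_measurable borel"
      unfolding G_def by measurable
    have G_ge: "ennreal (2 powr ((of_int j + 1) * p)) \<le> G x" if "x \<in> F j" for x j
    proof -
      have "(\<Sum>n\<in>{int_encode j}. ennreal (2 powr ((of_int (int_decode n) + 1) * p)) * indicator (F (int_decode n)) x) \<le> G x"
        unfolding G_def by (rule sum_le_suminf) auto
      then show ?thesis using that by simp
    qed
    have inF: "x \<in> F j"
      if x: "0 < l" "l \<le> L" "x \<in> cube a l" and j: "ennreal (2 powr of_int j) < average (cube a l) (\<lambda>y. ennreal (h y))"
      for x a :: "real^'n" and l j
    \<comment> \<open>Otherwise \<open>u j\<close> and the cut-off part would each contribute at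
      most \<open>2 powr (j - 1)\<close> to the average, in total no more than
      \<open>2 powr j\<close>.\<close>
    proof (rule F1[OF x], rule ccontr)
      let ?t = "ennreal (2 powr (of_int j - 1))"
      assume "\<not> ?t * ennreal (l ^ CARD('n)) \<le> (\<integral>\<^sup>+y\<in>cube a l. u j y \<partial>lborel)"
      then have le: "(\<integral>\<^sup>+y\<in>cube a l. u j y \<partial>lborel) \<le> ?t * ennreal (l ^ CARD('n))" by simp
      have "(\<integral>\<^sup>+y\<in>cube a l. ennreal (h y) \<partial>lborel)
          \<le> (\<integral>\<^sup>+y. u j y * indicator (cube a l) y + ?t * indicator (cube a l) y \<partial>lborel)"
        by (intro nn_integral_mono) (auto simp: u_def ennreal_leI split: split_indicator)
      also have "\<dots> = (\<integral>\<^sup>+y\<in>cube a l. u j y \<partial>lborel) + ?t * ennreal (l ^ CARD('n))"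
        using x(1) by (subst nn_integral_add) (auto simp: nn_integral_cmult emeasure_cube)
      also have "\<dots> \<le> ?t * ennreal (l ^ CARD('n)) + ?t * ennreal (l ^ CARD('n))"
        using le by (rule add_right_mono)
      also have "\<dots> = ennreal (2 powr of_int j) * ennreal (l ^ CARD('n))"
        using x(1) by (simp add: ennreal_mult[symmetric] ennreal_plus[symmetric] powr_diff del: ennreal_plus)
      finally have "average (cube a l) (\<lambda>y. ennreal (h y)) \<le> ennreal (2 powr of_int j)"
        using x(1) by (simp add: average_cube_le_iff)
      with j show False by simp
    qed
    show "\<exists>G\<in>borel_measurable borel.
      (\<forall>x a l. 0 < l \<and> l \<le> L \<and> x \<in> cube a l \<longrightarrow> epowr (average (cube a l) (\<lambda>y. ennreal (h y))) p \<le> G x) \<and>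
      (\<integral>\<^sup>+x. G x \<partial>lborel) \<le> ennreal (2 powr (p + 1) * K * B) * (\<integral>\<^sup>+y. ennreal (h y powr p) \<partial>lborel)"
    proof (intro bexI[OF _ G] conjI allI impI)
      fix x a :: "real^'n" and l assume "0 < l \<and> l \<le> L \<and> x \<in> cube a l"
      then have x: "0 < l" "l \<le> L" "x \<in> cube a l" by auto
      define m where "m = average (cube a l) (\<lambda>y. ennreal (h y))"
      have "epowr m p \<le> G x"
      proof (cases m)
        case (real t)
        show ?thesis
        proof (cases "t = 0")
          case True
          then show ?thesis using real by (simp add: epowr_def)
        next
          case False
          with real obtain j :: int where j: "2 powr of_int j < t" "t \<le> 2 powr (of_int j + 1)"
            using dyadic_level_exists[of t] by auto
          have "x \<in> F j"
            by (rule inF[OF x]) (use real j in \<open>simp add: m_def[symmetric] ennreal_less_iff\<close>)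
          have "epowr m p \<le> ennreal ((2 powr (of_int j + 1)) powr p)"
            using real j p by (auto simp: epowr_ennreal intro!: ennreal_leI powr_mono2)
          also have "\<dots> \<le> G x" using G_ge[OF \<open>x \<in> F j\<close>] by (simp add: powr_powr)
          finally show ?thesis .
        qed
      next
        case top
        \<comment> \<open>An infinite average puts \<open>x\<close> into every \<open>F j\<close>,
          so \<open>G x\<close> exceeds every real number.\<close>
        have "ennreal z \<le> G x" if "0 < z" for z
        proof -
          obtain j :: int where j: "z powr (1 / p) \<le> 2 powr (of_int j + 1)"
            using dyadic_level_exists[of "z powr (1 / p)"] \<open>0 < z\<close> by (metis powr_gt_zero less_irrefl)
          have "x \<in> F j"
            by (rule inF[OF x]) (use top in \<open>simp add: m_def[symmetric]\<close>)
          have "z = (z powr (1 / p)) powr p" using p that by (simp add: powr_powr)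
          also have "\<dots> \<le> (2 powr (of_int j + 1)) powr p" using j p by (intro powr_mono2) auto
          finally show ?thesis
            using G_ge[OF \<open>x \<in> F j\<close>] by (auto simp: powr_powr intro: order_trans ennreal_leI)
        qed
        have "G x = \<infinity>"
        proof (cases "G x")
          case (real g)
          with \<open>\<And>z. 0 < z \<Longrightarrow> ennreal z \<le> G x\<close>[of "g + 1"] show ?thesis by simp
        qed simp
        then show ?thesis by simp
      qed
      then show "epowr (average (cube a l) (\<lambda>y. ennreal (h y))) p \<le> G x" by (simp add: m_def)
    next
      \<comment> \<open>One factor \<open>2 powr (j - 1)\<close> is split off for the weak-type
        bound. The remaining exponent of the level is \<open>s = p - 1\<close>.\<close>
      have step: "ennreal (2 powr ((of_int j + 1) * p)) * emeasure lborel (F j)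
          \<le> (\<integral>\<^sup>+y. ennreal (2 powr (p + 1) * K) * (ennreal (2 powr (of_int j * s)) * u j y) \<partial>lborel)" for j :: int
      proof -
        have "ennreal (2 powr ((of_int j + 1) * p)) =
            ennreal (2 powr (p + 1)) * ennreal (2 powr (of_int j * s)) * ennreal (2 powr (of_int j - 1))"
          by (simp add: ennreal_mult[symmetric] powr_add[symmetric] s_def algebra_simps)
        then have "ennreal (2 powr ((of_int j + 1) * p)) * emeasure lborel (F j) =
            ennreal (2 powr (p + 1)) * ennreal (2 powr (of_int j * s)) *
              (ennreal (2 powr (of_int j - 1)) * emeasure lborel (F j))"
          by (simp add: mult.assoc)
        also have "\<dots> \<le> ennreal (2 powr (p + 1)) * ennreal (2 powr (of_int j * s)) *
              (ennreal K * (\<integral>\<^sup>+y. u j y \<partial>lborel))"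
          by (intro mult_left_mono F2) auto
        also have "\<dots> = ennreal (2 powr (p + 1) * K) * (ennreal (2 powr (of_int j * s)) * (\<integral>\<^sup>+y. u j y \<partial>lborel))"
          using K by (simp add: ennreal_mult ac_simps)
        also have "\<dots> = (\<integral>\<^sup>+y. ennreal (2 powr (p + 1) * K) * (ennreal (2 powr (of_int j * s)) * u j y) \<partial>lborel)"
          by (simp add: nn_integral_cmult)
        finally show ?thesis .
      qed
      have "(\<integral>\<^sup>+x. G x \<partial>lborel) =
          (\<Sum>n. ennreal (2 powr ((of_int (int_decode n) + 1) * p)) * emeasure lborel (F (int_decode n)))"
        unfolding G_def by (subst nn_integral_suminf) (auto simp: nn_integral_cmult)
      also have "\<dots> \<le> (\<Sum>n. \<integral>\<^sup>+y. ennreal (2 powr (p + 1) * K) *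
          (ennreal (2 powr (of_int (int_decode n) * s)) * u (int_decode n) y) \<partial>lborel)"
        by (intro suminf_le step) auto
      also have "\<dots> = (\<integral>\<^sup>+y. (\<Sum>n. ennreal (2 powr (p + 1) * K) *
          (ennreal (2 powr (of_int (int_decode n) * s)) * u (int_decode n) y)) \<partial>lborel)"
        by (subst nn_integral_suminf) auto
      \<comment> \<open>With sum and integral exchanged, only levels below \<open>2 * h y\<close>
        survive at \<open>y\<close>; their sum is a multiple of \<open>h y powr (p - 1)\<close>, and
        \<open>u\<close> supplies the last factor \<open>h y\<close>.\<close>
      also have "\<dots> \<le> (\<integral>\<^sup>+y. ennreal (2 powr (p + 1) * K * B) * ennreal (h y powr p) \<partial>lborel)"
      proof (intro nn_integral_mono)
        fix y
        let ?S = "\<Sum>n. ennreal (2 powr (of_int (int_decode n) * s)) *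
            indicator {j. 2 powr (of_int j - 1) < h y} (int_decode n)"
        have "(\<Sum>n. ennreal (2 powr (p + 1) * K) * (ennreal (2 powr (of_int (int_decode n) * s)) * u (int_decode n) y))
            = (\<Sum>n. ennreal (2 powr (p + 1) * K * h y) * (ennreal (2 powr (of_int (int_decode n) * s)) *
                indicator {j. 2 powr (of_int j - 1) < h y} (int_decode n)))"
          using K h0[of y] by (intro suminf_cong) (auto simp: u_def ennreal_mult ac_simps split: split_indicator)
        also have "\<dots> = ennreal (2 powr (p + 1) * K * h y) * ?S"
          by simp
        also have "\<dots> \<le> ennreal (2 powr (p + 1) * K * h y) * ennreal (B * h y powr s)"
          unfolding B_def using s h0 by (intro mult_left_mono dyadic_levels_sum_le) auto
        also have "\<dots> = ennreal (2 powr (p + 1) * K * B) * ennreal (h y powr p)"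
          using K B h0[of y] s by (cases "h y = 0")
            (auto simp: ennreal_mult[symmetric] powr_mult_base s_def ac_simps)
        finally show "(\<Sum>n. ennreal (2 powr (p + 1) * K) *
            (ennreal (2 powr (of_int (int_decode n) * s)) * u (int_decode n) y))
          \<le> ennreal (2 powr (p + 1) * K * B) * ennreal (h y powr p)" .
      qed
      also have "\<dots> = ennreal (2 powr (p + 1) * K * B) * (\<integral>\<^sup>+y. ennreal (h y powr p) \<partial>lborel)"
        by (simp add: nn_integral_cmult)
      finally show "(\<integral>\<^sup>+x. G x \<partial>lborel) \<le> ennreal (2 powr (p + 1) * K * B) * (\<integral>\<^sup>+y. ennreal (h y powr p) \<partial>lborel)" .
    qed
  qed
qed

section \<open>Large cubes and the theorem\<close>

text \<open>Dyadic cubes meeting the given cube reach beyond it by at most their side, hence by at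
  most \<open>l\<close>, in each direction. Being disjoint inside a cube of side
  \<open>3 * l\<close>, they have total measure at most its volume.\<close>

lemma set_nn_integral_dyadic_le:
  fixes g :: "real^'n \<Rightarrow> ennreal"
  assumes g [measurable]: "g \<in> borel_measurable borel"
    and R: "\<And>R. R \<in> dyadic_cubes \<mu> \<Longrightarrow> average R g \<le> t"
    and l: "2 powi (- \<mu>) \<le> l"
  shows "(\<integral>\<^sup>+x\<in>cube a l. g x \<partial>lborel) \<le> t * ennreal ((3 * l) ^ CARD('n))"
proof -
  define c :: real where "c = 2 powi (- \<mu>)"
  have c: "0 < c" "c \<le> l" using l by (auto simp: c_def)
  define Q where "Q m = (cube (\<chi> i. c * of_int (m $ i)) c :: (real^'n) set)" for m :: "int^'n"
  define I where "I = {m. Q m \<inter> cube a l \<noteq> {}}"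
  \<comment> \<open>The floor description yields both disjointness and covering.\<close>
  have Q: "x \<in> Q m \<longleftrightarrow> (\<forall>i. m $ i = \<lfloor>x $ i / c\<rfloor>)" for x m
  proof -
    have "c * of_int k \<le> y \<and> y < c * of_int k + c \<longleftrightarrow> k = \<lfloor>y / c\<rfloor>" for y k
    proof -
      have "c * of_int k \<le> y \<and> y < c * of_int k + c \<longleftrightarrow> of_int k \<le> y / c \<and> y / c < of_int k + 1"
        using c by (simp add: field_simps)
      then show ?thesis by (auto simp: floor_eq_iff eq_commute[of k])
    qed
    then show ?thesis by (simp add: Q_def cube_def)
  qed
  have disj: "disjoint_family_on Q I"
    by (auto simp: disjoint_family_on_def Q vec_eq_iff)
  have cover: "cube a l \<subseteq> (\<Union>m\<in>I. Q m)"
  proof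
    fix x assume "x \<in> cube a l"
    moreover have "x \<in> Q (\<chi> i. \<lfloor>x $ i / c\<rfloor>)" by (simp add: Q)
    ultimately show "x \<in> (\<Union>m\<in>I. Q m)" by (auto simp: I_def)
  qed
  have UN: "(\<Union>m\<in>I. Q m) \<subseteq> cube (a - (\<chi> i. c)) (3 * l)"
  proof
    fix x assume "x \<in> (\<Union>m\<in>I. Q m)"
    then obtain m y where m: "x \<in> Q m" "y \<in> Q m" "y \<in> cube a l" by (auto simp: I_def)
    show "x \<in> cube (a - (\<chi> i. c)) (3 * l)"
      unfolding cube_def
    proof (intro CollectI allI)
      fix i
      have "c * of_int (m $ i) \<le> x $ i" "x $ i < c * of_int (m $ i) + c"
        "c * of_int (m $ i) \<le> y $ i" "y $ i < c * of_int (m $ i) + c"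
        "a $ i \<le> y $ i" "y $ i < a $ i + l"
        using m by (auto simp: Q_def cube_def)
      then show "(a - (\<chi> i. c)) $ i \<le> x $ i \<and> x $ i < (a - (\<chi> i. c)) $ i + 3 * l"
        using c by simp
    qed
  qed
  have QR: "Q m \<in> dyadic_cubes \<mu>" for m
    by (auto simp: Q_def c_def dyadic_cubes_def)
  have sQ [measurable]: "Q m \<in> sets borel" for m
    by (simp add: Q_def)
  have I: "countable I" by (rule countableI_type)
  have "(\<integral>\<^sup>+x\<in>cube a l. g x \<partial>lborel) \<le> (\<integral>\<^sup>+x\<in>(\<Union>m\<in>I. Q m). g x \<partial>lborel)"
    using cover by (intro nn_integral_mono) (auto split: split_indicator)
  also have "\<dots> = (\<integral>\<^sup>+m. (\<integral>\<^sup>+x\<in>Q m. g x \<partial>lborel) \<partial>count_space I)"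
    by (intro nn_integral_UN_disjoint) (auto simp: I disj)
  also have "\<dots> \<le> (\<integral>\<^sup>+m. t * emeasure lborel (Q m) \<partial>count_space I)"
    using R[OF QR] c by (intro nn_integral_mono) (simp add: Q_def average_cube_le_iff emeasure_cube)
  also have "\<dots> = t * emeasure lborel (\<Union>m\<in>I. Q m)"
    by (subst emeasure_UN_countable) (auto simp: I disj nn_integral_cmult)
  also have "\<dots> \<le> t * ennreal ((3 * l) ^ CARD('n))"
    using emeasure_mono[OF UN, of lborel] c by (intro mult_left_mono) (auto simp: emeasure_cube)
  finally show ?thesis .
qed

text \<open>Replaces Jensen's inequality for averages of \<open>|f|\<^sup>r\<close>, at the cost of a constant.\<close>

lemma powr_le_interpolate:
  fixes x s :: real
  assumes "0 \<le> x" "0 < s" "r \<le> q" "0 < r"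
  shows "x powr r \<le> s powr r + s powr (r - q) * x powr q"
proof (cases "x \<le> s")
  case True
  then have "x powr r \<le> s powr r" using assms by (intro powr_mono2) auto
  then show ?thesis using assms by (simp add: add_increasing2)
next
  case False
  then have "x powr (r - q) \<le> s powr (r - q)"
    using assms by (intro powr_mono2') auto
  then have "x powr (r - q) * x powr q \<le> s powr (r - q) * x powr q"
    by (rule mult_right_mono) simp
  then show ?thesis using False assms by (simp add: powr_add[symmetric] add_increasing)
qed

text \<open>Averaging the previous inequality with threshold \<open>s\<close> gives
  \<open>s powr r + M * s powr r\<close>, since the bound on the average of order \<open>q\<close>
  cancels the factor \<open>s powr (r - q)\<close>.\<close>

lemma average_powr_le:
  fixes \<phi> :: "real^'n \<Rightarrow> complex"
  assumes \<phi> [measurable]: "\<phi> \<in> borel_measurable borel"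
    and rq: "0 < r" "r \<le> q" and s: "0 < s" and l: "0 < l" and M: "0 \<le> M"
    and le: "average (cube a l) (\<lambda>x. ennreal (norm (\<phi> x) powr q)) \<le> ennreal (M * s powr q)"
  shows "epowr (average (cube a l) (\<lambda>x. ennreal (norm (\<phi> x) powr r))) (1 / r) \<le> ennreal ((1 + M) powr (1 / r) * s)"
proof -
  have "(\<integral>\<^sup>+x\<in>cube a l. ennreal (norm (\<phi> x) powr r) \<partial>lborel)
      \<le> (\<integral>\<^sup>+x. ennreal (s powr r) * indicator (cube a l) x
          + ennreal (s powr (r - q)) * (ennreal (norm (\<phi> x) powr q) * indicator (cube a l) x) \<partial>lborel)"
    using powr_le_interpolate[OF norm_ge_zero s rq(2,1)]
    by (intro nn_integral_mono)
      (auto simp: ennreal_mult[symmetric] ennreal_plus[symmetric] simp del: ennreal_plus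
        intro!: ennreal_leI split: split_indicator)
  also have "\<dots> = ennreal (s powr r) * ennreal (l ^ CARD('n))
      + ennreal (s powr (r - q)) * (\<integral>\<^sup>+x\<in>cube a l. ennreal (norm (\<phi> x) powr q) \<partial>lborel)"
    using l by (subst nn_integral_add) (auto simp: nn_integral_cmult emeasure_cube)
  also have "\<dots> \<le> ennreal (s powr r) * ennreal (l ^ CARD('n))
      + ennreal (s powr (r - q)) * (ennreal (M * s powr q) * ennreal (l ^ CARD('n)))"
    using le l by (intro add_left_mono mult_left_mono) (auto simp: average_cube_le_iff)
  also have "\<dots> = ennreal ((1 + M) * s powr r) * ennreal (l ^ CARD('n))"
  proof -
    have "s powr (r - q) * (M * s powr q) = M * s powr r"
      using s by (simp add: powr_diff)
    then show ?thesis
      using l M by (simp add: ennreal_mult[symmetric] ennreal_plus[symmetric] algebra_simps del: ennreal_plus)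
  qed
  finally have "average (cube a l) (\<lambda>x. ennreal (norm (\<phi> x) powr r)) \<le> ennreal ((1 + M) * s powr r)"
    using l by (simp add: average_cube_le_iff)
  then have "epowr (average (cube a l) (\<lambda>x. ennreal (norm (\<phi> x) powr r))) (1 / r) \<le> epowr (ennreal ((1 + M) * s powr r)) (1 / r)"
    using rq by (intro epowr_mono) auto
  also have "\<dots> = ennreal ((1 + M) powr (1 / r) * s)"
    using rq s M by (simp add: epowr_ennreal powr_mult powr_powr)
  finally show ?thesis .
qed

text \<open>The factor 2 counts the two suprema.\<close>

lemma maximal_le:
  assumes "\<And>a l. \<lbrakk>0 < l; 2 powi k * l \<le> 1; x \<in> cube a l\<rbrakk> \<Longrightarrow>
      epowr (average (cube a l) (\<lambda>y. ennreal (norm (f y) powr r))) (1 / r) \<le> t"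
    and "\<And>a l. \<lbrakk>0 < l; 2 powi k * l > 1; x \<in> cube a l\<rbrakk> \<Longrightarrow>
      ennreal ((2 powi k * l) powr (- \<epsilon>)) *
        epowr (average (cube a l) (\<lambda>y. ennreal (norm (f y) powr r))) (1 / r) \<le> t"
  shows "maximal r k \<epsilon> f x \<le> ennreal 2 * t"
proof -
  have "maximal r k \<epsilon> f x \<le> t + t"
    unfolding maximal_def by (intro add_mono SUP_least) (use assms in auto)
  then show ?thesis by (simp add: mult_2)
qed

text \<open>This is the estimate in powers of order \<open>q\<close>, with a positive real
  \<open>s\<close> in place of the supremum. The constant is chosen before \<open>f\<close>, \<mu>,
  \<open>s\<close> and \<open>P\<close>.\<close>

lemma sum_maximal_average_le:
  fixes q r \<epsilon> :: real
  assumes r: "0 < r" and rq: "r < q" and \<epsilon>: "0 < \<epsilon>"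
  shows "\<exists>C>0. \<forall>(f :: int \<Rightarrow> real^'n \<Rightarrow> complex) \<mu> s. \<forall>P\<in>dyadic_cubes \<mu>.
    (\<forall>k. f k \<in> borel_measurable borel) \<and> 0 < s \<and>
    (\<forall>R\<in>dyadic_cubes \<mu>. average R (\<lambda>x. \<Sum>j. ennreal (norm (f (\<mu> + int j) x) powr q)) \<le> ennreal (s powr q)) \<longrightarrow>
    average P (\<lambda>x. \<Sum>j. epowr (maximal r (\<mu> + int j) \<epsilon> (f (\<mu> + int j)) x) q) \<le> ennreal (C * s powr q)"
proof -
  let ?d = "CARD('n)"
  have q: "0 < q" using r rq by simp
  have "1 < q / r" using r rq by simp
  from maximal_function_strong_type[OF this] obtain B where B: "0 < B"
    and strong: "\<And>(h :: real^'n \<Rightarrow> real) L. h \<in> borel_measurable borel \<Longrightarrow> (\<And>y. 0 \<le> h y) \<Longrightarrow>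
    (\<exists>G\<in>borel_measurable borel.
      (\<forall>x a l. 0 < l \<and> l \<le> L \<and> x \<in> cube a l \<longrightarrow> epowr (average (cube a l) (\<lambda>y. ennreal (h y))) (q / r) \<le> G x) \<and>
      (\<integral>\<^sup>+x. G x \<partial>lborel) \<le> ennreal B * (\<integral>\<^sup>+y. ennreal (h y powr (q / r)) \<partial>lborel))"
    by blast
  \<comment> \<open>\<open>D\<close> comes from \<open>average_powr_le\<close> with
    \<open>M = 3 ^ CARD('n)\<close>, the loss in covering a large cube by dyadic ones. Below,
    \<open>w\<close> is the ratio of the series of weights and \<open>E\<close> its sum times
    \<open>D powr q\<close>.\<close>
  define D where "D = (1 + 3 ^ ?d :: real) powr (1 / r)"
  define w where "w = 2 powr (- \<epsilon> * q)"
  define E where "E = D powr q * (1 / (1 - w))"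
  have "(0::real) < 1 + 3 ^ ?d" by (simp add: add_pos_pos)
  then have D: "0 < D" unfolding D_def by simp
  have w: "0 < w" "w < 1" using \<epsilon> q by (auto simp: w_def powr_less_one)
  have E: "0 < E" using D w by (simp add: E_def)
  show ?thesis
  \<comment> \<open>The factor \<open>2 powr q\<close> comes from the two suprema, the term with
    \<open>B\<close> from small cubes and \<open>E\<close> from large ones.\<close>
  proof (intro exI[of _ "2 powr q * (B * 9 ^ ?d + E)"] conjI allI ballI impI)
    show "0 < 2 powr q * (B * 9 ^ ?d + E)" using B E by (simp add: add_pos_pos)
    fix f :: "int \<Rightarrow> real^'n \<Rightarrow> complex" and \<mu> :: int and s :: real and P :: "(real^'n) set"
    assume P: "P \<in> dyadic_cubes \<mu>"
      and "(\<forall>k. f k \<in> borel_measurable borel) \<and> 0 < s \<and>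
        (\<forall>R\<in>dyadic_cubes \<mu>. average R (\<lambda>x. \<Sum>j. ennreal (norm (f (\<mu> + int j) x) powr q)) \<le> ennreal (s powr q))"
    then have f [measurable]: "\<And>k. f k \<in> borel_measurable borel" and s: "0 < s"
      and R: "\<And>R. R \<in> dyadic_cubes \<mu> \<Longrightarrow>
        average R (\<lambda>x. \<Sum>j. ennreal (norm (f (\<mu> + int j) x) powr q)) \<le> ennreal (s powr q)" by auto
    define c :: real where "c = 2 powi (- \<mu>)"
    have c: "0 < c" by (simp add: c_def)
    have powi: "2 powi (\<mu> + int j) * l = 2 ^ j * (l / c)" for j l
      by (simp add: c_def power_int_add power_int_minus field_simps)
    obtain b where Pb: "P = cube b c"
      using P by (auto simp: dyadic_cubes_def c_def)
    define N where "N = cube (b - (\<chi> i. c)) (3 * c)"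
    have N [measurable]: "N \<in> sets borel" by (simp add: N_def)
    have sub: "cube a l \<subseteq> N" if "x \<in> P" "x \<in> cube a l" "l \<le> c" for x a l
    proof
      fix y assume "y \<in> cube a l"
      then have "b $ i \<le> x $ i \<and> x $ i < b $ i + c \<and> a $ i \<le> x $ i \<and> x $ i < a $ i + l \<and> a $ i \<le> y $ i \<and> y $ i < a $ i + l" for i
        using that by (auto simp: Pb cube_def)
      then show "y \<in> N"
        using that unfolding N_def cube_def by simp (smt (verit))
    qed
    define F where "F j x = ennreal (norm (f (\<mu> + int j) x) powr q)" for j x
    have F [measurable]: "F j \<in> borel_measurable borel" for j
      unfolding F_def by measurable
    have big: "(\<integral>\<^sup>+x\<in>cube a l. (\<Sum>j. F j x) \<partial>lborel) \<le> ennreal (s powr q) * ennreal ((3 * l) ^ ?d)" if "c \<le> l" for a l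
      by (rule set_nn_integral_dyadic_le[where \<mu> = \<mu>]) (use R that in \<open>auto simp: F_def c_def\<close>)
    \<comment> \<open>Cutting off outside \<open>N\<close> keeps the global strong-type bound local.
      Raising to \<open>q / r\<close> gives the power \<open>q\<close> of the norm on
      \<open>N\<close> and still 0 elsewhere.\<close>
    define h where "h j y = norm (f (\<mu> + int j) y) powr r * indicator N y" for j y
    have h: "h j \<in> borel_measurable borel" for j
      unfolding h_def by measurable
    define W where "W j H \<longleftrightarrow> H \<in> borel_measurable borel \<and>
      (\<forall>x a l. 0 < l \<and> l \<le> c \<and> x \<in> cube a l \<longrightarrow> epowr (average (cube a l) (\<lambda>y. ennreal (h j y))) (q / r) \<le> H x) \<and>
      (\<integral>\<^sup>+x. H x \<partial>lborel) \<le> ennreal B * (\<integral>\<^sup>+y. ennreal (h j y powr (q / r)) \<partial>lborel)" for j H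
    have "\<exists>H. W j H" for j
      using strong[OF h, of j c] by (auto simp: W_def h_def)
    then obtain G where W: "\<And>j. W j (G j)"
      by metis
    then have G [measurable]: "\<And>j. G j \<in> borel_measurable borel"
      and G1: "\<And>j x a l. 0 < l \<Longrightarrow> l \<le> c \<Longrightarrow> x \<in> cube a l \<Longrightarrow>
        epowr (average (cube a l) (\<lambda>y. ennreal (h j y))) (q / r) \<le> G j x"
      and G2: "\<And>j. (\<integral>\<^sup>+x. G j x \<partial>lborel) \<le> ennreal B * (\<integral>\<^sup>+y. ennreal (h j y powr (q / r)) \<partial>lborel)"
      unfolding W_def by blast+
    have ptw: "epowr (maximal r (\<mu> + int j) \<epsilon> (f (\<mu> + int j)) x) q
        \<le> ennreal (2 powr q) * (G j x + ennreal (D powr q * s powr q * w ^ j))" if x: "x \<in> P" for j x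
    proof -
      let ?avg = "\<lambda>a l. epowr (average (cube a l) (\<lambda>y. ennreal (norm (f (\<mu> + int j) y) powr r))) (1 / r)"
      \<comment> \<open>The root of order \<open>q\<close> is undone when the maximal function is
        raised to the power \<open>q\<close>.\<close>
      let ?u = "epowr (G j x) (1 / q)" and ?v = "ennreal (D * s * 2 powr (- \<epsilon> * real j))"
      have small: "?avg a l \<le> ?u" if l: "0 < l" "l \<le> c" "x \<in> cube a l" for a l
      proof -
        have "average (cube a l) (\<lambda>y. ennreal (norm (f (\<mu> + int j) y) powr r)) = average (cube a l) (\<lambda>y. ennreal (h j y))"
          using sub[OF x l(3,2)] unfolding average_def
          by (intro arg_cong2[where f = "(/)"] nn_integral_cong) (auto simp: h_def split: split_indicator)
        then have "?avg a l = epowr (epowr (average (cube a l) (\<lambda>y. ennreal (h j y))) (q / r)) (1 / q)"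
          using q by (simp add: epowr_epowr)
        also have "\<dots> \<le> ?u" using q by (intro epowr_mono G1 l) auto
        finally show ?thesis .
      qed
      \<comment> \<open>The average of one term is controlled by that of the whole sum, and
        \<open>l > c\<close> makes \<open>2 powi k * l\<close> at least \<open>2 ^ j\<close>, where
        \<open>k\<close> is \<open>\<mu> + int j\<close>.\<close>
      have large: "ennreal ((2 powi (\<mu> + int j) * l) powr (- \<epsilon>)) * ?avg a l \<le> ?v" if l: "c < l" for a l
      proof -
        have l0: "0 < l" using c l by simp
        have "(\<integral>\<^sup>+x\<in>cube a l. F j x \<partial>lborel) \<le> (\<integral>\<^sup>+x\<in>cube a l. (\<Sum>j. F j x) \<partial>lborel)"
          using sum_le_suminf[of "\<lambda>j. F j _" "{j}"] by (intro nn_integral_mono mult_right_mono) auto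
        also have "\<dots> \<le> ennreal (s powr q) * ennreal ((3 * l) ^ ?d)"
          using l by (intro big) simp
        also have "\<dots> = ennreal (3 ^ ?d * s powr q) * ennreal (l ^ ?d)"
          using l0 by (simp add: ennreal_mult[symmetric] power_mult_distrib ac_simps)
        finally have "average (cube a l) (\<lambda>x. ennreal (norm (f (\<mu> + int j) x) powr q)) \<le> ennreal (3 ^ ?d * s powr q)"
          using l0 by (simp add: average_cube_le_iff F_def)
        then have avg: "?avg a l \<le> ennreal (D * s)"
          unfolding D_def using r rq s l0 by (intro average_powr_le) auto
        have "2 ^ j * 1 \<le> 2 ^ j * (l / c)" using l c by (intro mult_left_mono) auto
        then have "2 powr real j \<le> 2 powi (\<mu> + int j) * l"
          unfolding powi by (simp add: powr_realpow)
        then have "(2 powi (\<mu> + int j) * l) powr (- \<epsilon>) \<le> (2 powr real j) powr (- \<epsilon>)"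
          using \<epsilon> by (intro powr_mono2') auto
        also have "\<dots> = 2 powr (- \<epsilon> * real j)" by (simp add: powr_powr mult.commute)
        finally have "ennreal ((2 powi (\<mu> + int j) * l) powr (- \<epsilon>)) * ?avg a l
            \<le> ennreal (2 powr (- \<epsilon> * real j)) * ennreal (D * s)"
          using avg by (intro mult_mono ennreal_leI) auto
        also have "\<dots> = ?v" using D s by (simp add: ennreal_mult[symmetric] ac_simps)
        finally show ?thesis .
      qed
      \<comment> \<open>The maximal function separates cubes at side \<open>2 powi (- k)\<close>,
        the estimates at \<open>c\<close>, which is no smaller because \<open>k\<close> is at least
        \<mu>. Cubes between the two sizes carry a weight at most 1 and are treated as
        small.\<close>
      have "maximal r (\<mu> + int j) \<epsilon> (f (\<mu> + int j)) x \<le> ennreal 2 * max ?u ?v"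
      proof (rule maximal_le)
        fix a l assume l: "0 < l" "2 powi (\<mu> + int j) * l \<le> 1" "x \<in> cube a l"
        have "1 * (l / c) \<le> 2 ^ j * (l / c)" using l c by (intro mult_right_mono) auto
        then have "l / c \<le> 1" using l(2) unfolding powi by linarith
        then have "l \<le> c" using c by simp
        then show "?avg a l \<le> max ?u ?v" using small l by (simp add: le_max_iff_disj)
      next
        fix a l assume l: "0 < l" "2 powi (\<mu> + int j) * l > 1" "x \<in> cube a l"
        show "ennreal ((2 powi (\<mu> + int j) * l) powr (- \<epsilon>)) * ?avg a l \<le> max ?u ?v"
        proof (cases "l \<le> c")
          case True
          have "(2 powi (\<mu> + int j) * l) powr (- \<epsilon>) \<le> 1 powr (- \<epsilon>)"
            using l \<epsilon> by (intro powr_mono2') auto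
          then have "ennreal ((2 powi (\<mu> + int j) * l) powr (- \<epsilon>)) * ?avg a l \<le> 1 * ?u"
            using small[OF l(1) True l(3)] by (intro mult_mono) auto
          then show ?thesis by (simp add: le_max_iff_disj)
        next
          case False
          then show ?thesis using large by (simp add: le_max_iff_disj)
        qed
      qed
      then have "epowr (maximal r (\<mu> + int j) \<epsilon> (f (\<mu> + int j)) x) q \<le> epowr (ennreal 2 * max ?u ?v) q"
        using q by (intro epowr_mono) auto
      also have "\<dots> = ennreal (2 powr q) * epowr (max ?u ?v) q"
        using q by (intro epowr_mult_ennreal) auto
      also have "\<dots> \<le> ennreal (2 powr q) * (epowr ?u q + epowr ?v q)"
        by (intro mult_left_mono epowr_max_le) auto
      also have "epowr ?u q = G j x" using q by (rule epowr_inverse)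
      also have "epowr ?v q = ennreal (D powr q * s powr q * w ^ j)"
      proof -
        have "(2 powr (- \<epsilon> * real j)) powr q = w powr real j"
          by (simp add: w_def powr_powr ac_simps)
        then show ?thesis
          using D s w by (simp add: epowr_ennreal powr_mult powr_realpow)
      qed
      finally show ?thesis .
    qed
    have sumG: "(\<Sum>j. \<integral>\<^sup>+x. G j x \<partial>lborel) \<le> ennreal (B * 9 ^ ?d * s powr q) * ennreal (c ^ ?d)"
    proof -
      have "(\<Sum>j. \<integral>\<^sup>+x. G j x \<partial>lborel) \<le> (\<Sum>j. ennreal B * (\<integral>\<^sup>+x\<in>N. F j x \<partial>lborel))"
      proof (intro suminf_le)
        fix j
        have "(\<integral>\<^sup>+y. ennreal (h j y powr (q / r)) \<partial>lborel) = (\<integral>\<^sup>+x\<in>N. F j x \<partial>lborel)"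
          using r by (intro nn_integral_cong) (auto simp: h_def F_def powr_powr split: split_indicator)
        then show "(\<integral>\<^sup>+x. G j x \<partial>lborel) \<le> ennreal B * (\<integral>\<^sup>+x\<in>N. F j x \<partial>lborel)"
          using G2[of j] by simp
      qed auto
      also have "\<dots> = ennreal B * (\<Sum>j. \<integral>\<^sup>+x\<in>N. F j x \<partial>lborel)" by simp
      also have "(\<Sum>j. \<integral>\<^sup>+x\<in>N. F j x \<partial>lborel) = (\<integral>\<^sup>+x\<in>N. (\<Sum>j. F j x) \<partial>lborel)"
        by (subst nn_integral_suminf[symmetric]) auto
      \<comment> \<open>\<open>N\<close> has side \<open>3 * c\<close>, and covering it by dyadic
        cubes triples the side again, whence \<open>9 ^ CARD('n)\<close>.\<close>
      also have "ennreal B * \<dots> \<le> ennreal B * (ennreal (s powr q) * ennreal ((3 * (3 * c)) ^ ?d))"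
        unfolding N_def using c by (intro mult_left_mono big) auto
      also have "\<dots> = ennreal (B * 9 ^ ?d * s powr q) * ennreal (c ^ ?d)"
      proof -
        have "(3 * (3 * c)) ^ ?d = (9 * c) ^ ?d" by simp
        also have "\<dots> = 9 ^ ?d * c ^ ?d" by (rule power_mult_distrib)
        finally show ?thesis
          using B c by (simp only: ennreal_mult[symmetric] mult_nonneg_nonneg zero_le_power powr_ge_zero
              less_imp_le zero_le_numeral mult.assoc mult.left_commute)
      qed
      finally show ?thesis .
    qed
    have sums: "(\<lambda>j. D powr q * s powr q * w ^ j) sums (D powr q * s powr q * (1 / (1 - w)))"
      using w by (intro sums_mult geometric_sums) auto
    have geo: "(\<Sum>j. ennreal (D powr q * s powr q * w ^ j)) = ennreal (E * s powr q)"
    proof -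
      have "(\<Sum>j. ennreal (D powr q * s powr q * w ^ j)) = ennreal (D powr q * s powr q * (1 / (1 - w)))"
        using sums w by (intro suminf_ennreal_eq) auto
      then show ?thesis by (simp add: E_def ac_simps)
    qed
    \<comment> \<open>Only the constant from large cubes is restricted to \<open>P\<close>; each
      \<open>G j\<close> is integrated over the whole space, where its bound holds.\<close>
    have "(\<integral>\<^sup>+x\<in>P. (\<Sum>j. epowr (maximal r (\<mu> + int j) \<epsilon> (f (\<mu> + int j)) x) q) \<partial>lborel)
        \<le> (\<integral>\<^sup>+x. ennreal (2 powr q) * ((\<Sum>j. G j x) + ennreal (E * s powr q) * indicator P x) \<partial>lborel)"
    proof (intro nn_integral_mono)
      fix x
      show "(\<Sum>j. epowr (maximal r (\<mu> + int j) \<epsilon> (f (\<mu> + int j)) x) q) * indicator P x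
          \<le> ennreal (2 powr q) * ((\<Sum>j. G j x) + ennreal (E * s powr q) * indicator P x)"
      proof (cases "x \<in> P")
        case True
        have "(\<Sum>j. epowr (maximal r (\<mu> + int j) \<epsilon> (f (\<mu> + int j)) x) q)
            \<le> (\<Sum>j. ennreal (2 powr q) * (G j x + ennreal (D powr q * s powr q * w ^ j)))"
          by (intro suminf_le ptw True) auto
        also have "\<dots> = ennreal (2 powr q) * ((\<Sum>j. G j x) + (\<Sum>j. ennreal (D powr q * s powr q * w ^ j)))"
          by (simp add: suminf_add)
        finally show ?thesis using True by (simp add: geo)
      qed simp
    qed
    also have "\<dots> = ennreal (2 powr q) * ((\<Sum>j. \<integral>\<^sup>+x. G j x \<partial>lborel) + ennreal (E * s powr q) * ennreal (c ^ ?d))"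
      using c by (simp add: Pb nn_integral_cmult nn_integral_add nn_integral_suminf emeasure_cube)
    also have "\<dots> \<le> ennreal (2 powr q) * (ennreal (B * 9 ^ ?d * s powr q) * ennreal (c ^ ?d) + ennreal (E * s powr q) * ennreal (c ^ ?d))"
      by (intro mult_left_mono add_right_mono sumG) auto
    also have "\<dots> = ennreal (2 powr q * (B * 9 ^ ?d + E) * s powr q) * ennreal (c ^ ?d)"
      using B E c by (simp add: ennreal_mult[symmetric] ennreal_plus[symmetric] algebra_simps del: ennreal_plus)
    finally show "average P (\<lambda>x. \<Sum>j. epowr (maximal r (\<mu> + int j) \<epsilon> (f (\<mu> + int j)) x) q)
        \<le> ennreal (2 powr q * (B * 9 ^ ?d + E) * s powr q)"
      using c by (simp add: Pb average_cube_le_iff)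
  qed
qed

section \<open>From real bounds to the supremum\<close>

lemma smooth_borel_measurable: "smooth f \<Longrightarrow> f \<in> borel_measurable borel"
proof (rule borel_measurable_continuous_onI)
  assume "smooth f"
  then have "f differentiable (at x)" for x
    unfolding smooth_def by (metis lists.Nil partials.simps(1))
  then show "continuous_on UNIV f"
    by (simp add: continuous_at_imp_continuous_on differentiable_imp_continuous_within)
qed

theorem theorem1p3:
  fixes q r \<epsilon> A :: real
  assumes "0 < r" and "r < q" and "\<epsilon> > 0" and "A > 0"
  shows "\<exists>C::real. C > 0 \<and>
    (\<forall>(f :: int \<Rightarrow> real^'n \<Rightarrow> complex) (\<mu> :: int) (P :: (real^'n) set).
      (\<forall>k. f k \<in> band_limited (A * 2 powi k)) \<and> P \<in> dyadic_cubes \<mu> \<longrightarrow>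
      epowr (average P (\<lambda>x. \<Sum>j::nat. epowr (maximal r (\<mu> + int j) \<epsilon> (f (\<mu> + int j)) x) q)) (1 / q)
      \<le> ennreal C *
        (SUP R\<in>dyadic_cubes \<mu>.
          epowr (average R (\<lambda>x. \<Sum>j::nat. ennreal (norm (f (\<mu> + int j) x) powr q))) (1 / q)))"
proof -
  have q: "0 < q" using assms by simp
  from sum_maximal_average_le[OF assms(1-3)] obtain B where B: "0 < B"
    and main: "\<And>(f :: int \<Rightarrow> real^'n \<Rightarrow> complex) \<mu> s P. P \<in> dyadic_cubes \<mu> \<Longrightarrow>
      (\<And>k. f k \<in> borel_measurable borel) \<Longrightarrow> 0 < s \<Longrightarrow>
      (\<And>R. R \<in> dyadic_cubes \<mu> \<Longrightarrow> average R (\<lambda>x. \<Sum>j. ennreal (norm (f (\<mu> + int j) x) powr q)) \<le> ennreal (s powr q)) \<Longrightarrow>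
      average P (\<lambda>x. \<Sum>j. epowr (maximal r (\<mu> + int j) \<epsilon> (f (\<mu> + int j)) x) q) \<le> ennreal (B * s powr q)"
    by blast
  define C where "C = B powr (1 / q)"
  have C: "0 < C" using B by (simp add: C_def)
  show ?thesis
  proof (intro exI[of _ C] conjI allI impI C)
    fix f :: "int \<Rightarrow> real^'n \<Rightarrow> complex" and \<mu> :: int and P :: "(real^'n) set"
    assume "(\<forall>k. f k \<in> band_limited (A * 2 powi k)) \<and> P \<in> dyadic_cubes \<mu>"
    then have f: "f k \<in> borel_measurable borel" and P: "P \<in> dyadic_cubes \<mu>" for k
      by (auto simp: band_limited_def intro!: smooth_borel_measurable)
    let ?lhs = "epowr (average P (\<lambda>x. \<Sum>j::nat. epowr (maximal r (\<mu> + int j) \<epsilon> (f (\<mu> + int j)) x) q)) (1 / q)"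
    let ?avg = "\<lambda>R. average R (\<lambda>x. \<Sum>j::nat. ennreal (norm (f (\<mu> + int j) x) powr q))"
    define S where "S = (SUP R\<in>dyadic_cubes \<mu>. epowr (?avg R) (1 / q))"
    \<comment> \<open>Positive \<open>s\<close> above \<open>S\<close> rather than \<open>S\<close> itself, which may be \<open>0\<close> or \<open>\<infinity>\<close>.\<close>
    have le: "?lhs \<le> ennreal (C * s)" if s: "0 < s" "S \<le> ennreal s" for s
    proof -
      have "?avg R \<le> ennreal (s powr q)" if "R \<in> dyadic_cubes \<mu>" for R
      proof -
        have "epowr (?avg R) (1 / q) \<le> ennreal s"
          using that s(2) unfolding S_def by (meson SUP_upper order_trans)
        then have "epowr (epowr (?avg R) (1 / q)) q \<le> epowr (ennreal s) q"
          using q by (intro epowr_mono) auto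
        then show ?thesis using s q by (simp add: epowr_inverse epowr_ennreal)
      qed
      then have "?lhs \<le> epowr (ennreal (B * s powr q)) (1 / q)"
        using q s by (intro epowr_mono main P f) auto
      also have "\<dots> = ennreal (C * s)"
        using B s q by (simp add: epowr_ennreal powr_mult powr_powr C_def)
      finally show ?thesis .
    qed
    have "?lhs \<le> ennreal C * S"
    proof (cases S)
      case (real \<sigma>)
      show ?thesis
      proof (rule ennreal_le_epsilon)
        fix e :: real assume e: "0 < e"
        \<comment> \<open>Adding \<open>e / C\<close> makes the bound positive even if \<sigma> is
          0, and costs exactly \<open>e\<close> after multiplication by \<open>C\<close>.\<close>
        have "?lhs \<le> ennreal (C * (\<sigma> + e / C))"
          using real e C by (intro le) (auto intro: add_nonneg_pos ennreal_leI)
        also have "\<dots> = ennreal C * S + ennreal e"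
          using real e C by (simp add: ennreal_mult[symmetric] ennreal_plus[symmetric] algebra_simps del: ennreal_plus)
        finally show "?lhs \<le> ennreal C * S + ennreal e" .
      qed
    next
      case top
      then show ?thesis using C by (simp add: ennreal_mult_top)
    qed
    then show "?lhs \<le> ennreal C * (SUP R\<in>dyadic_cubes \<mu>. epowr (?avg R) (1 / q))"
      by (simp add: S_def)
  qed
qed

end
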